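(* For every integer $n \geq 3$ with $n \neq 5$, Left wins the Classic Variant of the Mixed Deletion Game played on the wheel $W_n$ regardless of which player moves first.
   Context: The Classic Variant of the Mixed Deletion Game is a two-player combinatorial game between Left and Right played on a finite simple undirected graph; players alternate turns. On her turn Left deletes one vertex together with all edges incident to it; on his turn Right deletes one edge. The game ends when a deletion creates an isolated vertex (a vertex of degree $0$), and the player whose deletion created an isolated vertex loses; thus a legal move is a deletion which does not create an isolated vertex, and a player with no legal move loses. The wheel $W_n$ is the graph consisting of a cycle on $n$ vertices together with one additional hub vertex adjacent to every vertex of the cycle. *)

theory Defs
  imports Main
begin

text \<open>
  A finite simple undirected graph is given by its vertex set and its set of edges, an edge being
  the two-element set of its endpoints.
\<close>

datatype 'a graph = Graph (verts: "'a set") (edges: "'a set set")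

definition simple_graph :: "'a graph \<Rightarrow> bool" where
  "simple_graph G \<longleftrightarrow> finite (verts G) \<and> (\<forall>e\<in>edges G. e \<subseteq> verts G \<and> card e = 2)"

definition degree :: "'a graph \<Rightarrow> 'a \<Rightarrow> nat" where
  "degree G v = card {e \<in> edges G. v \<in> e}"

definition isolated :: "'a graph \<Rightarrow> 'a \<Rightarrow> bool" where
  "isolated G v \<longleftrightarrow> v \<in> verts G \<and> degree G v = 0"

definition delete_vertex :: "'a graph \<Rightarrow> 'a \<Rightarrow> 'a graph" where
  "delete_vertex G v = Graph (verts G - {v}) {e \<in> edges G. v \<notin> e}"

definition delete_edge :: "'a graph \<Rightarrow> 'a set \<Rightarrow> 'a graph" where
  "delete_edge G e = Graph (verts G) (edges G - {e})"

datatype player = Left | Right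

fun opponent :: "player \<Rightarrow> player" where
  "opponent Left = Right"
| "opponent Right = Left"

fun deletions :: "player \<Rightarrow> 'a graph \<Rightarrow> 'a graph set" where
  "deletions Left G = delete_vertex G ` verts G"
| "deletions Right G = delete_edge G ` edges G"

definition creates_isolated :: "'a graph \<Rightarrow> 'a graph \<Rightarrow> bool" where
  "creates_isolated G H \<longleftrightarrow> (\<exists>v. isolated H v \<and> \<not> isolated G v)"

definition legal_moves :: "player \<Rightarrow> 'a graph \<Rightarrow> 'a graph set" where
  "legal_moves P G = {H \<in> deletions P G. \<not> creates_isolated G H}"

text \<open>
  \<open>wins P Q G\<close>: player \<open>P\<close> has a winning strategy from position \<open>G\<close> when \<open>Q\<close> is to move.
  A player without a legal move loses: rule \<open>own_turn\<close> needs a legal move, while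
  \<open>opponent_turn\<close> holds vacuously if the opponent has none.
\<close>

inductive wins :: "player \<Rightarrow> player \<Rightarrow> 'a graph \<Rightarrow> bool" for P :: player where
  own_turn: "H \<in> legal_moves P G \<Longrightarrow> wins P (opponent P) H \<Longrightarrow> wins P P G"
| opponent_turn:
    "(\<And>H. H \<in> legal_moves (opponent P) G \<Longrightarrow> wins P P H) \<Longrightarrow> wins P (opponent P) G"

text \<open>The wheel has rim vertices \<open>0, \<dots>, n - 1\<close> and hub \<open>n\<close>.\<close>

definition wheel :: "nat \<Rightarrow> nat graph" where
  "wheel n = Graph {0..n} ({{i, (i + 1) mod n} | i. i < n} \<union> {{i, n} | i. i < n})"

lemma simple_graph_wheel:
  assumes "n \<ge> 3"
  shows "simple_graph (wheel n)"
proof -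
  have "i \<noteq> Suc i mod n" if "i < n" for i
    using assms that by (cases "Suc i = n") auto
  moreover have "Suc i mod n \<le> n" for i
    using assms by (simp add: less_imp_le)
  ultimately show ?thesis
    by (auto simp: simple_graph_def wheel_def card_2_iff)
qed

lemma simple_graph_legal_moves:
  assumes "simple_graph G" "H \<in> legal_moves P G"
  shows "simple_graph H"
proof (cases P)
  case Left
  with assms show ?thesis
    unfolding simple_graph_def legal_moves_def by (fastforce simp: delete_vertex_def)
next
  case Right
  with assms show ?thesis
    unfolding simple_graph_def legal_moves_def by (clarsimp simp: delete_edge_def)
qed

end

theory Submission
  imports Defs
begin

text \<open>
  No legal position has an isolated vertex, so Left is stuck only on a disjoint union of copies
  of $K_2$. On a disjoint union of paths she wins moving first unless it is such a union: one of
  at most two candidate deletions leaves a position that is not $P_4$ plus copies of $K_2$, which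
  is the only kind of position that Right can turn into a union of copies of $K_2$. On the wheel
  Left deletes the hub as soon as she moves, which leaves Right to move on $C_n$ or, if he has
  already deleted a rim edge, on $P_n$. Only $P_4$ is bad for her; there she deletes an inner
  vertex of the rim path instead of the hub and leaves a triangle with a pendant edge.
\<close>

section \<open>Isolated vertices and legal moves\<close>

lemma isolated_iff:
  assumes "finite (edges G)"
  shows "isolated G v \<longleftrightarrow> v \<in> verts G \<and> (\<forall>e\<in>edges G. v \<notin> e)"
  \<comment> \<open>Finiteness matters here: \<open>card\<close> of an infinite set is 0, so a
    vertex of infinite degree would count as isolated.\<close>
  using assms by (auto simp: isolated_def degree_def)

lemma delete_vertex_legal:
  assumes "v \<in> verts G" and "\<And>u. \<not> isolated (delete_vertex G v) u"
  shows "delete_vertex G v \<in> legal_moves Left G"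
  using assms by (auto simp: legal_moves_def creates_isolated_def)

lemma Left_moves:
  assumes "v \<in> verts G" and "\<And>u. \<not> isolated (delete_vertex G v) u"
    and "wins Left Right (delete_vertex G v)"
  shows "wins Left Left G"
  using wins.own_turn[OF delete_vertex_legal[OF assms(1,2)]] assms(3) by simp

lemma Right_moves:
  assumes "\<And>e. e \<in> edges G \<Longrightarrow> delete_edge G e \<in> legal_moves Right G
    \<Longrightarrow> wins Left Left (delete_edge G e)"
  shows "wins Left Right G"
  using wins.opponent_turn[of Left G] assms by (force simp: legal_moves_def)

section \<open>Disjoint unions of paths\<close>

text \<open>
  The set \<open>I\<close> collects the indices of the edges \<open>{s i, s (i + 1)}\<close> that are present. As there are no
  isolated vertices, it determines the position.
\<close>

definition path_graph :: "(nat \<Rightarrow> 'a) \<Rightarrow> nat set \<Rightarrow> 'a graph" where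
  "path_graph s I = Graph (s ` (I \<union> Suc ` I)) ((\<lambda>i. {s i, s (Suc i)}) ` I)"

lemma not_isolated_path_graph:
  assumes "finite I"
  shows "\<not> isolated (path_graph s I) v"
  using assms by (subst isolated_iff) (auto simp: path_graph_def)

text \<open>A legal deletion leaves each endpoint of the deleted edge on another edge. These can
  only be the preceding and the following edge, so the deleted edge is inner and the vertex set
  stays that of a path graph.\<close>

lemma delete_edge_path_graph:
  assumes s: "inj s" and I: "finite I"
    and e: "e \<in> edges (path_graph s I)"
    and legal: "delete_edge (path_graph s I) e \<in> legal_moves Right (path_graph s I)"
  obtains i where "i \<in> I" "Suc i \<in> I" "Suc (Suc i) \<in> I"
    "delete_edge (path_graph s I) e = path_graph s (I - {Suc i})"
proof -
  let ?H = "delete_edge (path_graph s I) e"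
  from e obtain j where j: "j \<in> I" and e_def: "e = {s j, s (Suc j)}"
    by (auto simp: path_graph_def)
  have s_eq: "s a = s b \<longleftrightarrow> a = b" for a b
    using s by (simp add: inj_eq)
  have edges: "edges ?H = (\<lambda>i. {s i, s (Suc i)}) ` (I - {j})"
    by (auto simp: delete_edge_def path_graph_def e_def doubleton_eq_iff s_eq)
  have "\<not> isolated ?H v" for v
    using legal not_isolated_path_graph[OF I, of s]
    by (auto simp: legal_moves_def creates_isolated_def)
  then have cover: "\<exists>e'\<in>edges ?H. v \<in> e'" if "v \<in> verts ?H" for v
    using that I isolated_iff[of ?H v] by (auto simp: edges)
  have verts: "verts ?H = s ` (I \<union> Suc ` I)"
    by (simp add: delete_edge_def path_graph_def)
  have "\<exists>i\<in>I - {j}. j = i \<or> j = Suc i"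
    using cover[of "s j"] j by (auto simp: edges verts s_eq)
  then obtain i where i: "i \<in> I" "j = Suc i"
    by auto
  have "\<exists>k\<in>I - {j}. Suc j = k \<or> Suc j = Suc k"
    using cover[of "s (Suc j)"] j by (auto simp: edges verts s_eq)
  then have i2: "Suc j \<in> I"
    by auto
  have "j \<in> Suc ` (I - {j})" "Suc j \<in> I - {j}"
    using i i2 by auto
  then have "I \<union> Suc ` I = (I - {j}) \<union> Suc ` (I - {j})"
    by blast
  then have "?H = path_graph s (I - {j})"
    using edges verts by (intro graph.expand) (simp add: path_graph_def)
  with i i2 j that show thesis
    by blast
qed

text \<open>Some component has at least two edges, so the position is not a disjoint union of copies
  of $K_2$.\<close>

definition adj :: "nat set \<Rightarrow> bool" where
  "adj I \<longleftrightarrow> (\<exists>i\<in>I. Suc i \<in> I)"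

text \<open>No legal deletion by Right turns a robust position into a disjoint union of copies of $K_2$.\<close>

definition robust :: "nat set \<Rightarrow> bool" where
  "robust I \<longleftrightarrow> (\<forall>i. i \<in> I \<longrightarrow> Suc i \<in> I \<longrightarrow> Suc (Suc i) \<in> I \<longrightarrow> adj (I - {Suc i}))"

text \<open>The case \<open>leaf\<close> is the deletion of an end vertex of a component,
  \<open>middle\<close> that of an inner vertex with two edges on one side or more beyond its
  neighbours kept covered by \<open>i\<close> and \<open>Suc (Suc (Suc i))\<close>.\<close>

lemma robust_move:
  assumes "finite I" "adj I"
  obtains (leaf) i where "i \<in> I" "Suc i \<in> I" "Suc (Suc i) \<notin> I" "robust (I - {Suc i})"
  | (middle) i where "i \<in> I" "Suc i \<in> I" "Suc (Suc i) \<in> I" "Suc (Suc (Suc i)) \<in> I"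
      "robust (I - {Suc i, Suc (Suc i)})"
proof -
  \<comment> \<open>The topmost adjacent pair: \<open>t\<close> and \<open>Suc t\<close> are the
    last two edges of their component.\<close>
  define t where "t = Max {i \<in> I. Suc i \<in> I}"
  have "t \<in> {i \<in> I. Suc i \<in> I}"
    unfolding t_def using assms by (intro Max_in) (auto simp: adj_def)
  then have t: "t \<in> I" "Suc t \<in> I" by auto
  have max: "i \<le> t" if "i \<in> I" "Suc i \<in> I" for i
    unfolding t_def using assms that by (intro Max_ge) auto
  have t2: "Suc (Suc t) \<notin> I"
    using max[of "Suc t"] t by auto
  show thesis
  proof (cases "robust (I - {Suc t})")
    case True
    with leaf t t2 show thesis by blast
  next
    case False
    \<comment> \<open>Without \<open>Suc t\<close> the position is $P_4$, with edges
      \<open>i\<close> to \<open>Suc (Suc i)\<close>, plus copies of $K_2$.\<close>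
    then obtain i where i': "i \<in> I - {Suc t}" "Suc i \<in> I - {Suc t}"
        "Suc (Suc i) \<in> I - {Suc t}"
      and sparse: "\<not> adj (I - {Suc t} - {Suc i})"
      unfolding robust_def by blast
    then have i: "i \<in> I" "Suc i \<in> I" "Suc (Suc i) \<in> I"
      and i_ne: "i \<noteq> Suc t" "i \<noteq> t" "Suc i \<noteq> t"
      by blast+
    have lt: "Suc i < t"
      using max[of "Suc i"] i i_ne by auto
    have sparse': "k = Suc i \<or> k = i \<or> k = t \<or> k = Suc t" if "k \<in> I" "Suc k \<in> I" for k
      using sparse that by (auto simp: adj_def)
    show thesis
    \<comment> \<open>If equality holds, \<open>Suc t\<close> extended this $P_4$ to $P_5$, and
      deleting its centre leaves only copies of $K_2$. Otherwise $P_4$ and a separate $P_3$ with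
      edges \<open>t\<close> and \<open>Suc t\<close> are present, and the upper end of the $P_4$ is
      deleted.\<close>
    proof (cases "t = Suc (Suc i)")
      case True
      have "robust (I - {Suc i, Suc (Suc i)})"
        unfolding robust_def using sparse' True t2 by auto
      with middle i t True show thesis by blast
    next
      case False
      have i3: "Suc (Suc (Suc i)) \<notin> I"
        using sparse'[of "Suc (Suc i)"] i lt False by auto
      have "robust (I - {Suc (Suc i)})"
        unfolding robust_def
      proof (intro allI impI)
        fix k assume k: "k \<in> I - {Suc (Suc i)}" "Suc k \<in> I - {Suc (Suc i)}"
          "Suc (Suc k) \<in> I - {Suc (Suc i)}"
        \<comment> \<open>Neither edge of the $P_3$ lies between two others, so the pair survives
          every legal answer.\<close>
        have "Suc k \<noteq> t" "Suc k \<noteq> Suc t"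
          using sparse'[of k] k lt False t2 by auto
        then have "t \<in> I - {Suc (Suc i)} - {Suc k}" "Suc t \<in> I - {Suc (Suc i)} - {Suc k}"
          using t lt False by auto
        then show "adj (I - {Suc (Suc i)} - {Suc k})"
          unfolding adj_def by blast
      qed
      with leaf[of "Suc i"] i i3 show thesis by blast
    qed
  qed
qed

text \<open>Every move strictly shrinks \<open>I\<close>, so one induction over proper subsets
  proves both claims together, each feeding the other.\<close>

lemma Left_wins_path_graph:
  assumes "inj s"
  shows "finite I \<Longrightarrow> adj I \<Longrightarrow> wins Left Left (path_graph s I)"
    and "finite I \<Longrightarrow> robust I \<Longrightarrow> wins Left Right (path_graph s I)"
proof -
  have s_eq: "s a = s b \<longleftrightarrow> a = b" for a b
    using assms by (simp add: inj_eq)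
  have "finite I \<Longrightarrow> (adj I \<longrightarrow> wins Left Left (path_graph s I))
    \<and> (robust I \<longrightarrow> wins Left Right (path_graph s I))" for I
  proof (induction I rule: finite_psubset_induct)
    case (psubset I)
    have "wins Left Left (path_graph s I)" if "adj I"
      using psubset.hyps that
    proof (cases rule: robust_move)
      case (leaf i)
      \<comment> \<open>The edge \<open>i\<close> still covers the neighbour of the deleted end
        vertex.\<close>
      have "delete_vertex (path_graph s I) (s (Suc (Suc i))) = path_graph s (I - {Suc i})"
        using leaf(1-3) by (auto simp: delete_vertex_def path_graph_def s_eq)
      moreover have "wins Left Right (path_graph s (I - {Suc i}))"
        using psubset.IH[of "I - {Suc i}"] leaf by auto
      ultimately show ?thesis
        using leaf psubset.hyps
        by (intro Left_moves[of "s (Suc (Suc i))"])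
          (auto simp: not_isolated_path_graph, auto simp: path_graph_def)
    next
      case (middle i)
      let ?J = "I - {Suc i, Suc (Suc i)}"
      have "delete_vertex (path_graph s I) (s (Suc (Suc i))) = path_graph s ?J"
        using middle(1-4) by (auto simp: delete_vertex_def path_graph_def s_eq)
      moreover have "wins Left Right (path_graph s ?J)"
        using psubset.IH[of ?J] middle by auto
      ultimately show ?thesis
        using middle psubset.hyps
        by (intro Left_moves[of "s (Suc (Suc i))"])
          (auto simp: not_isolated_path_graph, auto simp: path_graph_def)
    qed
    moreover have "wins Left Right (path_graph s I)" if "robust I"
    proof (rule Right_moves)
      fix e assume "e \<in> edges (path_graph s I)"
        "delete_edge (path_graph s I) e \<in> legal_moves Right (path_graph s I)"
      with assms psubset.hyps obtain i where i: "i \<in> I" "Suc i \<in> I" "Suc (Suc i) \<in> I"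
        "delete_edge (path_graph s I) e = path_graph s (I - {Suc i})"
        by (rule delete_edge_path_graph)
      then show "wins Left Left (delete_edge (path_graph s I) e)"
        using psubset.IH[of "I - {Suc i}"] \<open>robust I\<close> by (auto simp: robust_def)
    qed
    ultimately show ?case by blast
  qed
  then show "finite I \<Longrightarrow> adj I \<Longrightarrow> wins Left Left (path_graph s I)"
    and "finite I \<Longrightarrow> robust I \<Longrightarrow> wins Left Right (path_graph s I)"
    by auto
qed

lemma adj_lessThan: "n \<ge> 3 \<Longrightarrow> adj {..<n - 1}"
  by (auto simp: adj_def intro!: bexI[of _ 0])

text \<open>The index set is that of $P_n$. Deleting edge 1 leaves the pair 2, 3, present once
  \<open>n\<close> is at least 5; deleting a later inner edge leaves the pair 0, 1.\<close>

lemma robust_lessThan: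
  assumes "n \<noteq> 4"
  shows "robust {..<n - 1}"
  unfolding robust_def
proof (intro allI impI)
  fix i assume i: "Suc (Suc i) \<in> {..<n - 1}"
  show "adj ({..<n - 1} - {Suc i})"
  proof (cases i)
    case 0
    with i assms show ?thesis
      by (auto simp: adj_def intro!: bexI[of _ 2])
  next
    case (Suc j)
    with i show ?thesis
      by (auto simp: adj_def intro!: bexI[of _ 0])
  qed
qed

section \<open>Cycles and their opening to paths\<close>

definition cycle_graph :: "nat \<Rightarrow> nat graph" where
  "cycle_graph n = Graph {..<n} {{i, (i + 1) mod n} | i. i < n}"

text \<open>Reads the rim from \<open>(k + 1) mod n\<close> round to \<open>k\<close>. Indices from
  \<open>n\<close> on are fixed, which makes the map injective on all naturals, as the path lemmas
  demand of \<open>s\<close>.\<close>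

definition rotation :: "nat \<Rightarrow> nat \<Rightarrow> nat \<Rightarrow> nat" where
  "rotation n k i =
    (if i + k + 1 < n then i + k + 1 else if i < n then i + k + 1 - n else i)"

lemma rotation_less: "k < n \<Longrightarrow> i < n \<Longrightarrow> rotation n k i < n"
  by (auto simp: rotation_def)

lemma inj_rotation: "k < n \<Longrightarrow> inj (rotation n k)"
  by (rule injI) (auto simp: rotation_def split: if_splits)

lemma rotation_Suc:
  assumes "k < n" "i < n - 1"
  shows "rotation n k (Suc i) = (rotation n k i + 1) mod n"
  using assms by (auto simp: rotation_def mod_Suc)

lemma rotation_image:
  assumes "n \<ge> 1" "k < n"
  shows "rotation n k ` {..<n} = {..<n}" "rotation n k ` {..<n - 1} = {..<n} - {k}"
proof -
  have inj: "inj_on (rotation n k) A" for A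
    using inj_rotation[OF assms(2)] by (rule inj_on_subset) simp
  show full: "rotation n k ` {..<n} = {..<n}"
    by (rule endo_inj_surj) (auto simp: rotation_less inj assms)
  have "rotation n k (n - 1) = k"
    using assms by (simp add: rotation_def)
  moreover have "{..<n - 1} = {..<n} - {n - 1}"
    using assms by auto
  ultimately show "rotation n k ` {..<n - 1} = {..<n} - {k}"
    using full inj_rotation[OF assms(2)] assms by (simp add: image_set_diff)
qed

text \<open>Ensures that deleting a rim edge removes one index only; for \<open>n = 2\<close> the
  indices 0 and 1 would name the same edge.\<close>

lemma cycle_edge_inj:
  fixes n :: nat
  assumes "n \<ge> 3" "i < n" "j < n" "{i, (i + 1) mod n} = {j, (j + 1) mod n}"
  shows "i = j"
  using assms by (auto simp: doubleton_eq_iff mod_Suc split: if_splits)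

lemma delete_edge_cycle_graph:
  assumes n: "n \<ge> 3" and k: "k < n"
  shows "delete_edge (cycle_graph n) {k, (k + 1) mod n} = path_graph (rotation n k) {..<n - 1}"
proof -
  let ?r = "rotation n k"
  have "?r (Suc i) = (?r i + 1) mod n" if "i < n - 1" for i
    using rotation_Suc[OF k that] .
  then have "(\<lambda>i. {?r i, ?r (Suc i)}) ` {..<n - 1} = (\<lambda>j. {j, (j + 1) mod n}) ` ?r ` {..<n - 1}"
    by (simp add: image_image)
  also have "\<dots> = (\<lambda>j. {j, (j + 1) mod n}) ` ({..<n} - {k})"
    using rotation_image[of n k] n k by simp
  also have "\<dots> = {{j, (j + 1) mod n} | j. j < n} - {{k, (k + 1) mod n}}"
    using cycle_edge_inj[OF n _ k] by blast
  finally have "(\<lambda>i. {?r i, ?r (Suc i)}) ` {..<n - 1} = \<dots>" .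
  moreover have "{..<n - 1} \<union> Suc ` {..<n - 1} = {..<n}"
  proof -
    have "x \<in> Suc ` {..<n - 1}" if "x < n" "x \<noteq> 0" for x
      using that by (cases x) auto
    then show ?thesis using n by fastforce
  qed
  ultimately show ?thesis
    using rotation_image(1)[of n k] n k by (simp add: path_graph_def cycle_graph_def delete_edge_def)
qed

lemma not_isolated_cycle_graph: "\<not> isolated (cycle_graph n) v"
proof -
  have "finite (edges (cycle_graph n))"
    by (simp add: cycle_graph_def)
  then show ?thesis
    by (subst isolated_iff) (auto simp: cycle_graph_def)
qed

text \<open>Whichever edge Right deletes, he leaves $P_n$ with at least two edges and Left to
  move.\<close>

lemma Left_wins_cycle_graph:
  assumes "n \<ge> 3"
  shows "wins Left Right (cycle_graph n)"
proof (rule Right_moves)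
  fix e assume "e \<in> edges (cycle_graph n)"
  then obtain k where "k < n" "e = {k, (k + 1) mod n}"
    by (auto simp: cycle_graph_def)
  then show "wins Left Left (delete_edge (cycle_graph n) e)"
    using delete_edge_cycle_graph[OF assms] Left_wins_path_graph(1)[OF inj_rotation[of k n]]
      adj_lessThan[OF assms] by simp
qed

text \<open>The hub \<open>n\<close> is no residue modulo \<open>n\<close>, so exactly the spokes
  vanish. In the second equation \<open>e\<close> may itself be a spoke; its deletion then does not
  affect the cycle.\<close>

lemma delete_hub:
  assumes "n \<ge> 3"
  shows "delete_vertex (wheel n) n = cycle_graph n"
    and "delete_vertex (delete_edge (wheel n) e) n = delete_edge (cycle_graph n) e"
proof -
  have ne: "n \<noteq> Suc i mod n" "Suc i mod n \<noteq> n" for i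
    using mod_less_divisor[of n "Suc i"] assms by (simp_all del: mod_less_divisor)
  have "{0..n} - {n} = {..<n}"
    by auto
  then show "delete_vertex (wheel n) n = cycle_graph n"
    and "delete_vertex (delete_edge (wheel n) e) n = delete_edge (cycle_graph n) e"
    using ne by (auto simp: delete_vertex_def delete_edge_def wheel_def cycle_graph_def)
qed

section \<open>Small graphs and the case of $W_4$\<close>

lemma Left_wins_P3:
  assumes "distinct [a, b, c]"
  shows "wins Left Right (Graph {a, b, c} {{a, b}, {b, c}})"
proof (rule Right_moves)
  let ?G = "Graph {a, b, c} {{a, b}, {b, c}}"
  fix e assume e: "e \<in> edges ?G" and legal: "delete_edge ?G e \<in> legal_moves Right ?G"
  \<comment> \<open>Each edge is the only one at an end vertex, so Right has no legal move.\<close>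
  have "isolated (delete_edge ?G e) (if e = {a, b} then a else c)"
    using assms e by (subst isolated_iff) (auto simp: delete_edge_def doubleton_eq_iff)
  moreover have "\<not> isolated ?G v" for v
    by (subst isolated_iff) auto
  ultimately show "wins Left Left (delete_edge ?G e)"
    using legal by (auto simp: legal_moves_def creates_isolated_def)
qed

lemma Left_wins_extend_P3:
  assumes "v \<in> verts G" "delete_vertex G v = Graph {a, b, c} {{a, b}, {b, c}}"
    and "distinct [a, b, c]"
  shows "wins Left Left G"
proof (rule Left_moves)
  show "\<not> isolated (delete_vertex G v) u" for u
    unfolding assms(2) by (subst isolated_iff) auto
qed (use assms Left_wins_P3[OF assms(3)] in simp_all)

lemma delete_vertex_Graph:
  "delete_vertex (Graph V (insert e E)) v =
    Graph (V - {v}) ((if v \<in> e then {} else {e}) \<union> edges (delete_vertex (Graph V E) v))"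
  "delete_vertex (Graph V {}) v = Graph (V - {v}) {}"
  by (auto simp: delete_vertex_def)

lemma delete_edge_Graph:
  "delete_edge (Graph V E) e = Graph V (E - {e})"
  by (simp add: delete_edge_def)

text \<open>Deleting the pendant edge would isolate \<open>a\<close>. After the loss of a triangle
  edge, \<open>c\<close> or \<open>d\<close> has degree one, and deleting it leaves $P_3$, where
  Right is stuck.\<close>

lemma Left_wins_paw:
  assumes "distinct [a, b, c, d]"
  shows "wins Left Right (Graph {a, b, c, d} {{a, b}, {b, c}, {b, d}, {c, d}})" (is "wins _ _ ?G")
proof (rule Right_moves)
  fix e assume e: "e \<in> edges ?G" and legal: "delete_edge ?G e \<in> legal_moves Right ?G"
  have "\<not> isolated ?G v" for v
    by (subst isolated_iff) auto
  then have "\<not> isolated (delete_edge ?G e) a"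
    using legal by (auto simp: legal_moves_def creates_isolated_def)
  then have "e \<noteq> {a, b}"
    using assms by (subst (asm) isolated_iff) (auto simp: delete_edge_def)
  then consider "e = {b, c}" | "e = {b, d}" | "e = {c, d}"
    using e by auto
  then show "wins Left Left (delete_edge ?G e)"
  proof cases
    case 1
    have "delete_vertex (delete_edge ?G e) c = Graph {a, b, d} {{a, b}, {b, d}}"
      using assms 1
      by (auto simp: delete_vertex_Graph delete_edge_Graph insert_Diff_if doubleton_eq_iff)
    then show ?thesis
      using assms by (intro Left_wins_extend_P3) (auto simp: delete_edge_def)
  next
    case 2
    have "delete_vertex (delete_edge ?G e) d = Graph {a, b, c} {{a, b}, {b, c}}"
      using assms 2
      by (auto simp: delete_vertex_Graph delete_edge_Graph insert_Diff_if doubleton_eq_iff)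
    then show ?thesis
      using assms by (intro Left_wins_extend_P3) (auto simp: delete_edge_def)
  next
    case 3
    have "delete_vertex (delete_edge ?G e) d = Graph {a, b, c} {{a, b}, {b, c}}"
      using assms 3
      by (auto simp: delete_vertex_Graph delete_edge_Graph insert_Diff_if doubleton_eq_iff)
    then show ?thesis
      using assms by (intro Left_wins_extend_P3) (auto simp: delete_edge_def)
  qed
qed

lemma wheel_4:
  "wheel 4 = Graph {0, 1, 2, 3, 4}
    {{0, 4}, {1, 4}, {2, 4}, {3, 4}, {0, 1}, {1, 2}, {2, 3}, {3, 0}}"
proof -
  have image: "{f i | i. i < 4} = {f 0, f 1, f 2, f 3}" for f :: "nat \<Rightarrow> nat set"
    by (auto simp: less_Suc_eq numeral_eq_Suc)
  have "{0..4} = {0, 1, 2, 3, 4 :: nat}"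
    by auto
  then show ?thesis
    using image[of "\<lambda>i. {i, (i + 1) mod 4}"] image[of "\<lambda>i. {i, 4}"]
    by (simp add: wheel_def numeral_2_eq_2[symmetric])
qed

lemma Left_wins_extend_paw:
  assumes "v \<in> verts G"
    "delete_vertex G v = Graph {a, b, c, d} {{a, b}, {b, c}, {b, d}, {c, d}}"
    and "distinct [a, b, c, d]"
  shows "wins Left Left G"
proof (rule Left_moves)
  show "\<not> isolated (delete_vertex G v) u" for u
    unfolding assms(2) by (subst isolated_iff) auto
qed (use assms Left_wins_paw[OF assms(3)] in simp_all)

lemma Left_wins_wheel_4_delete_rim:
  assumes "k < 4"
  shows "wins Left Left (delete_edge (wheel 4) {k, (k + 1) mod 4})"
proof -
  let ?G = "delete_edge (wheel 4) {k, (k + 1) mod 4}"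
  \<comment> \<open>The rim path left by Right runs through the entries of \<open>p\<close> and ends
    at \<open>k\<close>. Deleting its inner vertex \<open>p ! 1\<close> leaves the triangle
    \<open>4\<close>, \<open>p ! 2\<close>, \<open>k\<close> with the pendant vertex
    \<open>p ! 0\<close>.\<close>
  define p where "p = [(k + 1) mod 4, (k + 2) mod 4, (k + 3) mod 4]"
  consider "k = 0" | "k = 1" | "k = 2" | "k = 3"
    using assms by linarith
  then have "delete_vertex ?G (p ! 1) = Graph {p ! 0, 4, p ! 2, k}
      {{p ! 0, 4}, {4, p ! 2}, {4, k}, {p ! 2, k}}
    \<and> p ! 1 \<in> verts ?G \<and> distinct [p ! 0, 4, p ! 2, k]"
    by cases (simp_all add: p_def wheel_4 delete_vertex_Graph delete_edge_Graph
      insert_Diff_if doubleton_eq_iff, auto)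
  then show ?thesis
    by (elim conjE) (rule Left_wins_extend_paw)
qed

section \<open>Play on the wheel\<close>

lemma Left_wins_wheel_delete_edge:
  assumes n: "n \<ge> 3" and e: "e \<in> edges (wheel n)"
  shows "wins Left Left (delete_edge (wheel n) e)"
proof (cases "\<exists>k<n. e = {k, (k + 1) mod n}")
  case True
  then obtain k where k: "k < n" "e = {k, (k + 1) mod n}"
    by blast
  show ?thesis
  proof (cases "n = 4")
    case True
    then show ?thesis
      using Left_wins_wheel_4_delete_rim k by blast
  next
    case False
    have "delete_vertex (delete_edge (wheel n) e) n = path_graph (rotation n k) {..<n - 1}"
      using delete_hub(2)[OF n] delete_edge_cycle_graph[OF n] k by simp
    then show ?thesis
      using Left_wins_path_graph(2)[OF inj_rotation[OF k(1)] _ robust_lessThan[OF False]]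
      by (intro Left_moves[of n])
        (auto simp: not_isolated_path_graph, auto simp: delete_edge_def wheel_def)
  qed
next
  case False
  \<comment> \<open>Here \<open>e\<close> is a spoke, so the rim is intact.\<close>
  then have "e \<notin> edges (cycle_graph n)"
    by (auto simp: cycle_graph_def)
  then have "delete_vertex (delete_edge (wheel n) e) n = cycle_graph n"
    using delete_hub(2)[OF n] by (simp add: delete_edge_def)
  then show ?thesis
    using Left_wins_cycle_graph[OF n]
    by (intro Left_moves[of n])
      (auto simp: not_isolated_cycle_graph, auto simp: delete_edge_def wheel_def)
qed

theorem theorem3p6:
  fixes n :: nat
  assumes "n \<ge> 3" and "n \<noteq> 5"
  shows "\<forall>first. wins Left first (wheel n)"
proof
  fix first
  show "wins Left first (wheel n)"
  proof (cases first)
    case Left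
    have "wins Left Left (wheel n)"
      using delete_hub(1)[OF assms(1)] Left_wins_cycle_graph[OF assms(1)]
      by (intro Left_moves[of n])
        (auto simp: not_isolated_cycle_graph, auto simp: wheel_def)
    with Left show ?thesis by simp
  next
    case Right
    with Left_wins_wheel_delete_edge[OF assms(1)] show ?thesis
      by (auto intro: Right_moves)
  qed
qed

end
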